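(* Each function $f\in\mathcal{F}_H^0$ maps $\mathbb{D}$ onto a domain bounded by a rectifiable Jordan curve.
   Context: $\mathbb{D}=\{z\in\mathbb{C}:|z|<1\}$. $\mathcal{F}_H^0$ is the class of all complex-valued harmonic functions $f$ in $\mathbb{D}$ with $f(0)=0$, $f_z(0)=1$, $f_{\bar z}(0)=0$ and $|f_z(z)-1|<1-|f_{\bar z}(z)|$ for all $z\in\mathbb{D}$. *)

theory Defs
  imports "HOL-Complex_Analysis.Complex_Analysis"
begin

text \<open>
  The derivative of \<open>f\<close> at \<open>z\<close> along the real direction \<open>v\<close>:
  \<open>f\<^sub>x\<close> for \<open>v = 1\<close>, \<open>f\<^sub>y\<close> for \<open>v = \<i>\<close>.  The value is meaningful
  only where the derivative exists, which \<open>C1_on\<close> requires.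
\<close>

definition partial :: "complex \<Rightarrow> (complex \<Rightarrow> complex) \<Rightarrow> complex \<Rightarrow> complex" where
  "partial v f z = vector_derivative (\<lambda>t::real. f (z + of_real t * v)) (at 0)"

text \<open>\<open>C1_on\<close>, \<open>C2_on\<close> and \<open>harmonic_on\<close> are meant for open \<open>S\<close>.\<close>

definition C1_on :: "complex set \<Rightarrow> (complex \<Rightarrow> complex) \<Rightarrow> bool" where
  "C1_on S f \<longleftrightarrow> continuous_on S f \<and>
     (\<forall>v\<in>{1, \<i>}.
        (\<forall>z\<in>S. (\<lambda>t::real. f (z + of_real t * v)) differentiable (at 0)) \<and>
        continuous_on S (partial v f))"

definition C2_on :: "complex set \<Rightarrow> (complex \<Rightarrow> complex) \<Rightarrow> bool" where
  "C2_on S f \<longleftrightarrow> C1_on S f \<and> C1_on S (partial 1 f) \<and> C1_on S (partial \<i> f)"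

definition harmonic_on :: "complex set \<Rightarrow> (complex \<Rightarrow> complex) \<Rightarrow> bool" where
  "harmonic_on S f \<longleftrightarrow> C2_on S f \<and>
     (\<forall>z\<in>S. partial 1 (partial 1 f) z + partial \<i> (partial \<i> f) z = 0)"

text \<open>The Wirtinger derivatives \<open>f\<^sub>z\<close> and \<open>f\<close> with respect to the conjugate variable.\<close>

definition wirtinger :: "(complex \<Rightarrow> complex) \<Rightarrow> complex \<Rightarrow> complex" where
  "wirtinger f z = (partial 1 f z - \<i> * partial \<i> f z) / 2"

definition wirtinger_bar :: "(complex \<Rightarrow> complex) \<Rightarrow> complex \<Rightarrow> complex" where
  "wirtinger_bar f z = (partial 1 f z + \<i> * partial \<i> f z) / 2"

text \<open>
  The class \<open>\<F>\<^sub>H\<^sup>0\<close>.  Functions are total on \<open>complex\<close>, but membership depends only on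
  the values in the open unit disc.
\<close>

definition FH0 :: "(complex \<Rightarrow> complex) set" where
  "FH0 = {f. harmonic_on (ball 0 1) f \<and>
             f 0 = 0 \<and> wirtinger f 0 = 1 \<and> wirtinger_bar f 0 = 0 \<and>
             (\<forall>z\<in>ball 0 1. cmod (wirtinger f z - 1) < 1 - cmod (wirtinger_bar f z))}"

text \<open>Finite length: the lengths of all inscribed polygons are bounded.\<close>

definition rectifiable_path :: "(real \<Rightarrow> complex) \<Rightarrow> bool" where
  "rectifiable_path g \<longleftrightarrow> path g \<and>
     (\<exists>L. \<forall>n. \<forall>t :: nat \<Rightarrow> real.
        mono_on {..n} t \<and> t ` {..n} \<subseteq> {0..1} \<longrightarrow>
        (\<Sum>k<n. dist (g (t k)) (g (t (Suc k)))) \<le> L)"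

end

theory Submission
  imports Defs
begin

text \<open>
  Let \<open>p\<close> and \<open>r\<close> be the derivatives of \<open>f\<close> with respect to \<open>z\<close> and to the
  conjugate variable, and write \<open>f = id + k\<close>.  The real derivative of \<open>k\<close> is
  \<open>w \<mapsto> (p - 1) * w + r * cnj w\<close>, whose operator norm is at most
  \<open>q = |p - 1| + |r|\<close>, and the inequality that defines the class says
  exactly that \<open>q < 1\<close> on the disc.  So \<open>k\<close> is \<open>1\<close>-Lipschitz there and has a
  \<open>1\<close>-Lipschitz extension \<open>g\<close> to the closed disc; hence \<open>f\<close> has the \<open>2\<close>-Lipschitz
  extension \<open>F = id + g\<close>.

  The bound \<open>q < 1\<close> need not be uniform up to the circle, but the closed disc is strictly convex:
  a chord between any two distinct points \<open>a\<close>, \<open>b\<close> has its midpoint in the open disc, and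
  near that midpoint \<open>q\<close> is bounded by a constant below \<open>1\<close>.  The distance gained on that
  piece of the chord is enough for \<open>|g(a) - g(b)| < |a - b|\<close>
  (\<open>dist_less_if_contracting_near_segment_point\<close>), which makes \<open>F\<close> injective on the closed disc.

  An injective continuous map of the closed disc sends the circle to a Jordan curve and the open
  disc onto the inside of that curve (\<open>Jordan_domain_of_closed_disc_embedding\<close>), and the curve
  is rectifiable because the Lipschitz map \<open>F\<close> parametrises it by the circle.
\<close>

section \<open>The real derivative in terms of the Wirtinger derivatives\<close>

lemma has_vector_derivative_along_direction:
  assumes "(\<lambda>t::real. f (z + of_real t * v)) differentiable (at 0)"
  shows "((\<lambda>t. f (z + of_real (t - s) * v)) has_vector_derivative partial v f z) (at s)"
proof -
  have "((\<lambda>t::real. f (z + of_real t * v)) has_vector_derivative partial v f z) (at 0)"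
    using assms unfolding partial_def by (simp add: vector_derivative_works)
  moreover have "((\<lambda>t. t - s) has_vector_derivative 1) (at s)"
    by (auto intro!: derivative_eq_intros)
  ultimately show ?thesis
    using vector_diff_chain_at[of "\<lambda>t. t - s" 1 s "\<lambda>t. f (z + of_real t * v)"]
    by (simp add: o_def)
qed

text \<open>
  Continuous partial derivatives give total differentiability.  The general result of this kind
  is about maps on a product, so \<open>f\<close> is pulled back to a box of real pairs around \<open>z\<close>;
  the box has a convex second side because the mean value inequality is applied along it.
\<close>

lemma C1_on_imp_has_derivative:
  assumes "open S" "C1_on S f" "z \<in> S"
  shows "(f has_derivative (\<lambda>w. Re w *\<^sub>R partial 1 f z + Im w *\<^sub>R partial \<i> f z)) (at z)"
proof -
  have diff: "(\<lambda>t::real. f (w + of_real t * v)) differentiable (at 0)"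
    if "v \<in> {1, \<i>}" "w \<in> S" for v w
    using assms(2) that by (auto simp: C1_on_def)
  have cont: "continuous_on S (partial \<i> f)"
    using assms(2) by (auto simp: C1_on_def)
  let ?C = "\<lambda>p. Complex (fst p) (snd p)"
  have contC: "continuous_on A ?C" for A :: "(real \<times> real) set"
    unfolding Complex_eq by (intro continuous_intros)
  have "open (?C -` S)"
    by (rule open_vimage[OF \<open>open S\<close> contC])
  moreover have "(Re z, Im z) \<in> ?C -` S"
    using assms by simp
  ultimately obtain A B where AB: "open A" "open B" "(Re z, Im z) \<in> A \<times> B" "A \<times> B \<subseteq> ?C -` S"
    by (rule open_prod_elim)
  then obtain e where e: "e > 0" "ball (Im z) e \<subseteq> B"
    by (auto elim: openE)
  define Y where "Y = ball (Im z) e"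
  have Y: "open Y" "convex Y" "Im z \<in> Y"
    using e by (auto simp: Y_def)
  have AY: "Complex x y \<in> S" if "x \<in> A" "y \<in> Y" for x y
    using AB e that by (force simp: Y_def)
  have dx: "((\<lambda>x. f (Complex x (Im z))) has_derivative (\<lambda>h. h *\<^sub>R partial 1 f z)) (at (Re z) within A)"
  proof -
    have "z + of_real (x - Re z) * 1 = Complex x (Im z)" for x
      by (simp add: complex_eq_iff)
    then show ?thesis
      using has_vector_derivative_along_direction[OF diff[of 1 z], of "Re z"] assms
      by (simp add: has_vector_derivative_def has_derivative_at_withinI)
  qed
  have dy: "((\<lambda>y. f (Complex x y)) has_derivative
      blinfun_apply (blinfun_scaleR_left (partial \<i> f (Complex x y)))) (at y within Y)"
    if "x \<in> A" "y \<in> Y" for x y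
  proof -
    have "Complex x y + of_real (t - y) * \<i> = Complex x t" for t
      by (simp add: complex_eq_iff)
    then show ?thesis
      using has_vector_derivative_along_direction[OF diff[of \<i> "Complex x y"], of y] AY[OF that]
      by (simp add: has_vector_derivative_def has_derivative_at_withinI)
  qed
  have "continuous_on (A \<times> Y) (\<lambda>p. blinfun_scaleR_left (partial \<i> f (?C p)))"
    using AY by (intro continuous_intros continuous_on_compose2[OF cont contC]) auto
  then have "continuous (at (Re z, Im z) within A \<times> Y)
      (\<lambda>(x, y). blinfun_scaleR_left (partial \<i> f (Complex x y)))"
    using AB Y by (auto simp: continuous_on_eq_continuous_within case_prod_beta')
  from has_derivative_partialsI[OF dx dy this Y(3,2)]
  have "((\<lambda>(x, y). f (Complex x y)) has_derivative
      (\<lambda>(s, t). s *\<^sub>R partial 1 f z + t *\<^sub>R partial \<i> f z)) (at (Re z, Im z))"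
    using AB Y by (simp add: at_within_open[OF _ open_Times])
  moreover have "((\<lambda>w. (Re w, Im w)) has_derivative (\<lambda>w. (Re w, Im w))) (at z)"
    by (auto intro!: derivative_eq_intros)
  ultimately show ?thesis
    using diff_chain_at[of "\<lambda>w. (Re w, Im w)"] by (fastforce simp: o_def)
qed

lemma C1_on_imp_has_derivative_wirtinger:
  assumes "open S" "C1_on S f" "z \<in> S"
  shows "(f has_derivative (\<lambda>w. wirtinger f z * w + wirtinger_bar f z * cnj w)) (at z)"
proof -
  have "Re w *\<^sub>R partial 1 f z + Im w *\<^sub>R partial \<i> f z
      = wirtinger f z * w + wirtinger_bar f z * cnj w" for w
    by (simp add: wirtinger_def wirtinger_bar_def complex_eq_iff field_simps)
  then show ?thesis
    using C1_on_imp_has_derivative[OF assms] by simp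
qed

section \<open>Strict contraction\<close>

text \<open>
  Travel from \<open>a\<close> to \<open>b\<close> along the segment: the triangle inequality loses nothing for
  collinear points in order, \<open>k\<close> increases no distance on any piece, and it strictly shortens
  the short piece \<open>[m, p]\<close> that starts at \<open>m\<close>.
\<close>

lemma dist_less_if_contracting_near_segment_point:
  fixes k :: "'a::real_normed_vector \<Rightarrow> 'b::metric_space"
  assumes lip: "1-lipschitz_on S k" and ab: "a \<in> S" "b \<in> S"
    and m: "m \<in> open_segment a b" "ball m e \<subseteq> S" "e > 0"
    and c: "c-lipschitz_on (ball m e) k" "c < 1"
  shows "dist (k a) (k b) < dist a b"
proof -
  obtain u where u: "0 < u" "u < 1" "a \<noteq> b" "m = (1 - u) *\<^sub>R a + u *\<^sub>R b"
    using m(1) by (auto simp: in_segment)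
  define d where "d = norm (b - a)"
  have d: "d > 0" using u by (simp add: d_def)
  \<comment> \<open>The piece \<open>[m, p]\<close> has length \<open>s d\<close>; it must neither overshoot \<open>b\<close> nor leave the ball.\<close>
  define s where "s = min (1 - u) (e / (2 * d))"
  have s: "0 < s" "s \<le> 1 - u" "s * d < e"
  proof -
    show "0 < s" "s \<le> 1 - u" using u d m by (auto simp: s_def)
    have "s * d \<le> e / (2 * d) * d"
      using d by (intro mult_right_mono) (auto simp: s_def)
    then show "s * d < e" using d m(3) by simp
  qed
  define p where "p = m + s *\<^sub>R (b - a)"
  have "m - a = u *\<^sub>R (b - a)" "p - m = s *\<^sub>R (b - a)" "b - p = (1 - u - s) *\<^sub>R (b - a)"
    by (simp_all add: u p_def algebra_simps)
  then have "norm (m - a) = u * d" "norm (p - m) = s * d" "norm (b - p) = (1 - u - s) * d"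
    using s u by (simp_all only: d_def norm_scaleR abs_of_nonneg abs_of_pos diff_ge_0_iff_ge)
  then have dists: "dist a m = u * d" "dist m p = s * d" "dist p b = (1 - u - s) * d"
    by (simp_all only: dist_norm norm_minus_commute)
  have mp: "m \<in> ball m e" "p \<in> ball m e"
    using s m dists by auto
  then have mpS: "m \<in> S" "p \<in> S"
    using m(2) by auto
  have "dist (k a) (k b) \<le> dist (k a) (k m) + dist (k m) (k p) + dist (k p) (k b)"
    by (meson add_mono dist_triangle dual_order.trans order_refl)
  also have "\<dots> \<le> dist a m + c * dist m p + dist p b"
    using lipschitz_onD[OF lip, of a m] lipschitz_onD[OF lip, of p b]
      lipschitz_onD[OF c(1), of m p] mp mpS ab by auto
  also have "\<dots> < dist a m + dist m p + dist p b"
    using c(2) s d dists by simp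
  also have "\<dots> = dist a b"
    unfolding dists by (simp add: d_def dist_norm norm_minus_commute algebra_simps)
  finally show ?thesis .
qed

section \<open>Jordan domains with rectifiable boundary\<close>

text \<open>
  Let \<open>U\<close> be the image of the open disc, \<open>K\<close> that of the closed disc and \<open>J\<close> the curve,
  so that \<open>K\<close> is the disjoint union of \<open>U\<close> and \<open>J\<close>.  Invariance of domain makes \<open>U\<close>
  open and compactness makes \<open>- K\<close> open, so these two sets separate the complement of \<open>J\<close>:
  each of the connected sets inside and outside of \<open>J\<close> lies in one of them.  The outside is
  unbounded, so it cannot lie in \<open>U\<close>; the nonempty set \<open>U\<close> must then be the whole inside.
\<close>

lemma Jordan_domain_of_closed_disc_embedding:
  fixes F :: "complex \<Rightarrow> complex"
  assumes cont: "continuous_on (cball 0 1) F" and inj: "inj_on F (cball 0 1)"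
  defines "\<gamma> \<equiv> F \<circ> circlepath 0 1"
  shows "simple_path \<gamma>" "pathfinish \<gamma> = pathstart \<gamma>"
    "frontier (F ` ball 0 1) = path_image \<gamma>" "F ` ball 0 1 = inside (path_image \<gamma>)"
proof -
  have sub: "sphere 0 1 \<subseteq> (cball 0 1 :: complex set)" "ball 0 1 \<subseteq> (cball 0 1 :: complex set)"
    by auto
  show simple: "simple_path \<gamma>"
    unfolding \<gamma>_def
    by (rule simple_path_continuous_image)
      (use sub in \<open>auto simp: simple_path_circlepath intro: continuous_on_subset[OF cont] inj_on_subset[OF inj]\<close>)
  show closed: "pathfinish \<gamma> = pathstart \<gamma>"
    by (simp add: \<gamma>_def pathfinish_compose pathstart_compose)
  let ?U = "F ` ball 0 1" and ?K = "F ` cball 0 1" and ?J = "path_image \<gamma>"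
  have J: "?J = F ` sphere 0 1"
    by (simp add: \<gamma>_def path_image_compose)
  have K: "?K = ?U \<union> ?J"
    unfolding J image_Un[symmetric] by (rule arg_cong[of _ _ "image F"]) auto
  have disj: "?U \<inter> ?J = {}"
    unfolding J using inj_on_image_Int[OF inj sub(2,1)] by auto
  have openU: "open ?U"
    by (rule invariance_of_domain)
      (use sub in \<open>auto intro: continuous_on_subset[OF cont] inj_on_subset[OF inj]\<close>)
  have compK: "compact ?K"
    using cont by (intro compact_continuous_image) auto
  have "bounded ?K" "open (- ?K)"
    using compK by (auto simp: compact_imp_bounded compact_imp_closed)
  note jordan = Jordan_inside_outside[OF simple closed]
  have dichotomy: "?U \<inter> C = {} \<or> - ?K \<inter> C = {}" if "connected C" "C \<inter> ?J = {}" for C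
    by (rule connectedD[OF that(1) openU \<open>open (- ?K)\<close>]) (use K that(2) in auto)
  have "\<not> outside ?J \<subseteq> ?K"
    using jordan bounded_subset[OF \<open>bounded ?K\<close>] by blast
  then have "?U \<inter> outside ?J = {}"
    using dichotomy[of "outside ?J"] jordan outside_no_overlap[of ?J] by auto
  moreover have "?U \<subseteq> inside ?J \<union> outside ?J"
    using jordan disj by auto
  ultimately have Uin: "?U \<subseteq> inside ?J"
    by blast
  moreover have "?U \<noteq> {}" by simp
  ultimately have "?U \<inter> inside ?J \<noteq> {}"
    by (simp only: Int_absorb2 not_False_eq_True)
  then have "inside ?J \<subseteq> ?K"
    using dichotomy[of "inside ?J"] jordan inside_no_overlap[of ?J] by auto
  moreover have "inside ?J \<inter> ?J = {}"
    by (rule inside_no_overlap)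
  ultimately have "inside ?J \<subseteq> ?U"
    unfolding K by blast
  then show "?U = inside ?J"
    using Uin by (rule equalityI[rotated])
  then show "frontier ?U = ?J"
    using jordan by simp
qed

lemma lipschitz_imp_rectifiable_path:
  assumes lip: "L-lipschitz_on {0..1} g"
  shows "rectifiable_path g"
  unfolding rectifiable_path_def
proof (intro conjI exI allI impI)
  show "path g"
    using lip by (simp add: path_def lipschitz_on_continuous_on)
  fix n and t :: "nat \<Rightarrow> real"
  assume t: "mono_on {..n} t \<and> t ` {..n} \<subseteq> {0..1}"
  then have t01: "t k \<in> {0..1}" if "k \<le> n" for k
    using that by auto
  have "(\<Sum>k<n. dist (g (t k)) (g (t (Suc k)))) \<le> (\<Sum>k<n. L * (t (Suc k) - t k))"
  proof (rule sum_mono)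
    fix k assume "k \<in> {..<n}"
    then have "t k \<le> t (Suc k)" "t k \<in> {0..1}" "t (Suc k) \<in> {0..1}"
      using t t01[of k] t01[of "Suc k"] mono_onD[of "{..n}" t k "Suc k"] by auto
    then show "dist (g (t k)) (g (t (Suc k))) \<le> L * (t (Suc k) - t k)"
      using lipschitz_onD[OF lip, of "t k" "t (Suc k)"] by (simp add: dist_real_def)
  qed
  also have "\<dots> = L * (t n - t 0)"
    by (simp add: sum_distrib_left[symmetric] sum_lessThan_telescope)
  also have "\<dots> \<le> L * 1"
    using t01[of 0] t01[of n] lipschitz_on_nonneg[OF lip] by (intro mult_left_mono) auto
  finally show "(\<Sum>k<n. dist (g (t k)) (g (t (Suc k)))) \<le> L" by simp
qed

lemma circlepath_lipschitz: "(2 * pi * \<bar>r\<bar>)-lipschitz_on S (circlepath z r)"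
proof (rule lipschitz_on_subset[OF bounded_derivative_imp_lipschitz[OF _ convex_UNIV]])
  fix x :: real
  show "(circlepath z r has_derivative
      (\<lambda>h. h *\<^sub>R (2 * pi * \<i> * r * exp (2 * of_real pi * \<i> * x)))) (at x within UNIV)"
    using has_vector_derivative_circlepath[of z r x] by (simp add: has_vector_derivative_def)
  show "onorm (\<lambda>h. h *\<^sub>R (2 * pi * \<i> * r * exp (2 * of_real pi * \<i> * x))) \<le> 2 * pi * \<bar>r\<bar>"
    by (rule onorm_bound) (auto simp: norm_mult norm_exp_eq_Re)
qed auto

section \<open>The image of the disc\<close>

theorem theorem3p1:
  fixes f :: "complex \<Rightarrow> complex"
  assumes "f \<in> FH0"
  shows "open (f ` ball 0 1) \<and> connected (f ` ball 0 1) \<and>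
         (\<exists>\<gamma>. simple_path \<gamma> \<and> pathfinish \<gamma> = pathstart \<gamma> \<and> rectifiable_path \<gamma> \<and>
              frontier (f ` ball 0 1) = path_image \<gamma> \<and>
              f ` ball 0 1 = inside (path_image \<gamma>))"
proof -
  let ?D = "ball 0 1 :: complex set"
  have C1: "C1_on ?D f"
    using assms by (simp add: FH0_def harmonic_on_def C2_on_def)
  define q where "q z = cmod (wirtinger f z - 1) + cmod (wirtinger_bar f z)" for z
  have q1: "q z < 1" if "z \<in> ?D" for z
    using assms that by (force simp: FH0_def q_def)
  have contq: "continuous_on ?D q"
    using C1 unfolding q_def wirtinger_def wirtinger_bar_def C1_on_def
    by (intro continuous_intros) auto
  define k where "k z = f z - z" for z
  \<comment> \<open>Used twice: on the whole disc with \<open>c = 1\<close>, and on small balls with some \<open>c < 1\<close>.\<close>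
  have k_lip: "c-lipschitz_on T k"
    if T: "convex T" "T \<subseteq> ?D" "\<And>z. z \<in> T \<Longrightarrow> q z \<le> c" "0 \<le> c" for T c
  proof (rule bounded_derivative_imp_lipschitz[OF _ T(1) _ T(4)])
    fix z assume z: "z \<in> T"
    let ?k' = "\<lambda>w. (wirtinger f z - 1) * w + wirtinger_bar f z * cnj w"
    have "(f has_derivative (\<lambda>w. wirtinger f z * w + wirtinger_bar f z * cnj w)) (at z)"
      using C1_on_imp_has_derivative_wirtinger[OF _ C1] T z by auto
    from has_derivative_diff[OF this has_derivative_ident]
    show "(k has_derivative ?k') (at z within T)"
      unfolding k_def by (rule has_derivative_at_withinI[THEN has_derivative_eq_rhs])
        (auto simp: algebra_simps)
    show "onorm ?k' \<le> c"
    proof (rule onorm_bound[OF T(4)])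
      fix w
      have "cmod (?k' w) \<le> cmod ((wirtinger f z - 1) * w) + cmod (wirtinger_bar f z * cnj w)"
        by (rule norm_triangle_ineq)
      also have "\<dots> = q z * cmod w"
        by (simp add: q_def norm_mult distrib_right)
      also have "\<dots> \<le> c * cmod w"
        using T(3)[OF z] by (intro mult_right_mono) auto
      finally show "cmod (?k' w) \<le> c * cmod w" .
    qed
  qed
  have "1-lipschitz_on ?D k"
    using q1 by (intro k_lip) (auto intro: less_imp_le)
  then obtain g where g: "1-lipschitz_on (cball 0 1) g" "\<And>z. z \<in> ?D \<Longrightarrow> g z = k z"
    using lipschitz_extend_closure[of 1 ?D k] by auto
  have strict: "dist (g a) (g b) < dist a b"
    if ab: "a \<in> cball 0 1" "b \<in> cball 0 1" "a \<noteq> b" for a b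
  proof -
    define m where "m = midpoint a b"
    have "m \<in> open_segment a b"
      using ab by (simp add: m_def)
    moreover from this have "m \<in> ?D"
      using dist_decreases_open_segment[of m a b 0] ab by auto
    then obtain e where e: "e > 0" "cball m e \<subseteq> ?D"
      using open_contains_cball open_ball by blast
    have sub: "ball m e \<subseteq> ?D"
      using ball_subset_cball e(2) by (rule order_trans)
    \<comment> \<open>By compactness \<open>q\<close> attains its supremum near \<open>m\<close>, which is therefore below \<open>1\<close>.\<close>
    obtain y where y: "y \<in> cball m e" "\<And>z. z \<in> cball m e \<Longrightarrow> q z \<le> q y"
      using continuous_attains_sup[of "cball m e" q] continuous_on_subset[OF contq e(2)] e(1)
      by auto
    have "(q y)-lipschitz_on (ball m e) k"
      using e y by (intro k_lip) (auto simp: q_def)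
    then have "(q y)-lipschitz_on (ball m e) g"
      by (rule lipschitz_on_transform) (use g(2) sub in blast)
    moreover have "q y < 1"
      using q1 y(1) e by auto
    moreover have "ball m e \<subseteq> cball 0 1"
      using sub by force
    ultimately show ?thesis
      using dist_less_if_contracting_near_segment_point[OF g(1) ab(1,2)] e(1) by blast
  qed
  define F where "F z = z + g z" for z
  have F_eq: "f ` ball 0 1 = F ` ball 0 1"
    by (rule image_cong) (auto simp: F_def g(2) k_def)
  have F_lip: "2-lipschitz_on (cball 0 1) F"
    unfolding F_def using lipschitz_on_add[OF lipschitz_on_id g(1)] by simp
  then have F_cont: "continuous_on (cball 0 1) F"
    by (rule lipschitz_on_continuous_on)
  have F_inj: "inj_on F (cball 0 1)"
  proof (rule inj_onI, rule ccontr)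
    fix a b assume ab: "a \<in> cball 0 1" "b \<in> cball 0 1" "F a = F b" "a \<noteq> b"
    then have "g a - g b = b - a"
      by (simp add: F_def algebra_simps)
    then show False
      using strict[OF ab(1,2,4)] by (simp add: dist_norm norm_minus_commute)
  qed
  define \<gamma> where "\<gamma> = F \<circ> circlepath 0 1"
  note jordan = Jordan_domain_of_closed_disc_embedding[OF F_cont F_inj, folded \<gamma>_def F_eq]
  have "circlepath 0 1 ` {0..1} \<subseteq> (cball 0 1 :: complex set)"
    using path_image_circlepath[of 0 1] by (auto simp: path_image_def)
  then have "(2 * (2 * pi * \<bar>1\<bar>))-lipschitz_on {0..1} \<gamma>"
    unfolding \<gamma>_def
    by (intro lipschitz_on_compose circlepath_lipschitz lipschitz_on_subset[OF F_lip])
  then have "rectifiable_path \<gamma>"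
    by (rule lipschitz_imp_rectifiable_path)
  moreover have "open (f ` ball 0 1)" "connected (f ` ball 0 1)"
    using Jordan_inside_outside[OF jordan(1,2)] jordan(4) by simp_all
  ultimately show ?thesis
    using jordan by blast
qed

end
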